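(* Let $Z$ be a symmetric real random variable with a $\mathcal{C}^\infty$ probability density function $\eta$ such that $\mathbb{E}[Z^2]=1$, $\mathbb{E}[Z^4]=3$ and $\eta^*_m\ge0$ on $\mathbb{R}$ for all $m\ge1$. Then $Z\sim\mathcal{N}(0,1)$.
   Context: For a density $\eta$ and $m\ge1$, $\eta^*_m(z)=(-1)^{m-1}\sum_{j=1}^mc_{j,m}z^j\eta^{(j)}(z)$, where $c_{1,1}=-1$ and for $m\ge2$, $1\le j\le m$, $$c_{j,m}=\Big(\frac{2j}{m-1}-4\Big)c_{j,m-1}\mathbf{1}_{j<m}+\frac{2}{m-1}c_{j-1,m-1}\mathbf{1}_{j>1}.$$ *)

theory Defs
  imports "HOL-Probability.Probability"
begin

definition smooth :: "(real \<Rightarrow> real) \<Rightarrow> bool" where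
  "smooth f \<longleftrightarrow> (\<forall>n x. (deriv ^^ n) f field_differentiable (at x))"

text \<open>
  \<open>star_coeff j m\<close> is $c_{j,m}$, meant for $1 \le j \le m$ and set to $0$ for all other indices.
  In the recursive equation $m$ is \<open>Suc (Suc k)\<close>, so $m - 1$ is \<open>Suc k\<close>.
\<close>
fun star_coeff :: "nat \<Rightarrow> nat \<Rightarrow> real" where
  "star_coeff j 0 = 0"
| "star_coeff j (Suc 0) = (if j = 1 then -1 else 0)"
| "star_coeff j (Suc (Suc k)) =
    (if 1 \<le> j \<and> j \<le> Suc (Suc k)
     then (2 * real j / real (Suc k) - 4) * star_coeff j (Suc k) * of_bool (j < Suc (Suc k))
          + 2 / real (Suc k) * star_coeff (j - 1) (Suc k) * of_bool (1 < j)
     else 0)"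

definition star :: "(real \<Rightarrow> real) \<Rightarrow> nat \<Rightarrow> real \<Rightarrow> real" where
  "star \<eta> m z = (-1) ^ (m - 1) * (\<Sum>j=1..m. star_coeff j m * z ^ j * (deriv ^^ j) \<eta> z)"

definition symmetric_rv :: "'a measure \<Rightarrow> ('a \<Rightarrow> real) \<Rightarrow> bool" where
  "symmetric_rv M Z \<longleftrightarrow> distr M borel Z = distr M borel (\<lambda>\<omega>. - Z \<omega>)"

end

theory Submission
  imports Defs "HOL-Real_Asymp.Real_Asymp"
begin

text \<open>
  Put \<open>h(x) = \<eta>(\<surd>x)\<close>. The recursion for the coefficients makes \<open>\<eta>\<^sup>*\<^sub>m(z)\<close> a positive multiple of
  \<open>(-1)\<^sup>m x\<^sup>m h\<^sup>(\<^sup>m\<^sup>)(x)\<close> at \<open>x = z\<^sup>2\<close>, so the hypothesis says that \<open>h\<close> is completely monotone; by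
  Bernstein's theorem \<open>\<eta>\<close> would be a mixture of centred Gaussians, and the fourth moment forces the
  mixing variance to be constant. Bernstein's theorem is avoided by working at finite order: for
  \<open>q\<^sub>N(z) = (-1)\<^sup>N h\<^sup>(\<^sup>N\<^sup>)(z\<^sup>2)\<close>, Taylor's formula at infinity represents \<open>\<eta>(y)\<close> as an integral of an explicit
  kernel against \<open>z\<^sup>2\<^sup>N q\<^sub>N(z) dz\<close>. Tonelli's theorem computes the total mass and the moments of order
  2 and 4 of this measure from those of \<open>\<eta>\<close>; they show that \<open>z\<^sup>2/(2N)\<close> concentrates at 1, and the
  kernel at this point tends to the Gaussian density as \<open>N \<rightarrow> \<infinity>\<close>.
\<close>

section \<open>The coefficient recursion and the derivatives of \<open>\<eta>\<close> as a function
  of the squared variable\<close>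

lemma star_coeff_outside: "j = 0 \<or> m < j \<Longrightarrow> star_coeff j m = 0"
  by (cases "(j, m)" rule: star_coeff.cases) auto

text \<open>The truncation factors of the recursion only discard coefficients that already vanish.
  Without them and without the denominator it is linear in j, the form in which the Euler operator
  produces it.\<close>

lemma star_coeff_Suc:
  assumes "1 \<le> m" "1 \<le> j" "j \<le> Suc m"
  shows "real m * star_coeff j (Suc m)
    = (2 * real j - 4 * real m) * star_coeff j m + 2 * star_coeff (j - 1) m"
proof -
  obtain k where m: "m = Suc k" using assms(1) by (cases m) auto
  have *: "star_coeff j (Suc k) * of_bool (j < Suc (Suc k)) = star_coeff j (Suc k)"
    using star_coeff_outside[of j "Suc k"] by (cases "j < Suc (Suc k)") auto
  have **: "star_coeff (j - 1) (Suc k) * of_bool (1 < j) = star_coeff (j - 1) (Suc k)"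
    using star_coeff_outside[of "j - 1" "Suc k"] by (cases "1 < j") auto
  have "star_coeff j (Suc (Suc k)) = (2 * real j / real (Suc k) - 4) * star_coeff j (Suc k)
      + 2 / real (Suc k) * star_coeff (j - 1) (Suc k)"
    using assms unfolding m star_coeff.simps
    by (simp only: mult.assoc * ** if_True simp_thms)
  then show ?thesis unfolding m by (simp add: field_simps del: star_coeff.simps of_nat_Suc)
qed

lemma smooth_derivs:
  assumes "smooth \<eta>"
  shows "((deriv ^^ j) \<eta> has_real_derivative (deriv ^^ Suc j) \<eta> z) (at z)"
  using assms unfolding smooth_def by (simp add: field_differentiable_derivI)

text \<open>With \<open>\<theta> = z d/dz\<close>, the coefficient recursion says
  \<open>\<eta>\<^sup>*\<^sub>m\<^sub>+\<^sub>1 = -(2/m) (\<theta> - 2m) \<eta>\<^sup>*\<^sub>m\<close>.\<close>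
lemma star_has_derivative:
  assumes "smooth \<eta>" "1 \<le> m" "z \<noteq> 0"
  shows "(star \<eta> m has_real_derivative
    (2 * real m * star \<eta> m z - real m / 2 * star \<eta> (Suc m) z) / z) (at z)"
proof -
  let ?c = "\<lambda>j. star_coeff j m" and ?d = "\<lambda>j. z ^ j * (deriv ^^ j) \<eta> z"
  let ?D = "(-1) ^ (m - 1) * (\<Sum>j=1..m. ?c j *
      (real j * z ^ (j - 1) * (deriv ^^ j) \<eta> z + z ^ j * (deriv ^^ Suc j) \<eta> z))"
  have "((\<lambda>z. star \<eta> m z) has_real_derivative ?D) (at z)"
    unfolding star_def
    by (rule derivative_eq_intros refl smooth_derivs[OF assms(1)] | simp add: algebra_simps)+
  \<comment> \<open>Multiplication by z gives the Euler operator. It sends z^j times the j-th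
    derivative to j times itself plus the term of index j+1, so the claim becomes an identity
    between coefficients.\<close>
  moreover have "z * ?D = 2 * real m * star \<eta> m z - real m / 2 * star \<eta> (Suc m) z"
  proof -
    have "z * (\<Sum>j=1..m. ?c j *
        (real j * z ^ (j - 1) * (deriv ^^ j) \<eta> z + z ^ j * (deriv ^^ Suc j) \<eta> z))
      = (\<Sum>j=1..m. real j * ?c j * ?d j + ?c j * ?d (Suc j))"
      unfolding sum_distrib_left
    proof (rule sum.cong[OF refl])
      fix j assume "j \<in> {1..m}"
      then obtain i where "j = Suc i" by (cases j) auto
      then show "z * (?c j * (real j * z ^ (j - 1) * (deriv ^^ j) \<eta> z + z ^ j * (deriv ^^ Suc j) \<eta> z))
        = real j * ?c j * ?d j + ?c j * ?d (Suc j)"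
        by (simp add: algebra_simps del: star_coeff.simps)
    qed
    also have "\<dots> = (\<Sum>j=1..m. real j * ?c j * ?d j) + (\<Sum>j=1..m. ?c j * ?d (Suc j))"
      by (rule sum.distrib)
    \<comment> \<open>Both sums are brought to the range 1..m+1. The terms added carry coefficients
      of index m+1 and, after the shift, of index 0, which vanish.\<close>
    also have "(\<Sum>j=1..m. real j * ?c j * ?d j) = (\<Sum>j=1..Suc m. real j * ?c j * ?d j)"
      by (simp add: star_coeff_outside)
    also have "(\<Sum>j=1..m. ?c j * ?d (Suc j)) = (\<Sum>j=Suc 1..Suc m. ?c (j - 1) * ?d j)"
      by (subst sum.shift_bounds_cl_Suc_ivl) simp
    also have "\<dots> = (\<Sum>j=1..Suc m. ?c (j - 1) * ?d j)"
      by (subst (2) sum.atLeast_Suc_atMost) (auto simp: star_coeff_outside)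
    also have "(\<Sum>j=1..Suc m. real j * ?c j * ?d j) + (\<Sum>j=1..Suc m. ?c (j - 1) * ?d j)
      = (\<Sum>j=1..Suc m. real m / 2 * (star_coeff j (Suc m) * ?d j) + 2 * real m * (?c j * ?d j))"
      unfolding sum.distrib[symmetric]
    proof (rule sum.cong[OF refl])
      fix j assume "j \<in> {1..Suc m}"
      then have r: "real j * ?c j + ?c (j - 1) = real m / 2 * star_coeff j (Suc m) + 2 * real m * ?c j"
        using star_coeff_Suc[of m j] assms(2) by (simp add: algebra_simps)
      have "real j * ?c j * ?d j + ?c (j - 1) * ?d j = (real j * ?c j + ?c (j - 1)) * ?d j"
        by (simp only: algebra_simps)
      then show "real j * ?c j * ?d j + ?c (j - 1) * ?d j
        = real m / 2 * (star_coeff j (Suc m) * ?d j) + 2 * real m * (?c j * ?d j)"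
        unfolding r by (simp only: algebra_simps)
    qed
    also have "\<dots> = real m / 2 * (\<Sum>j=1..Suc m. star_coeff j (Suc m) * ?d j)
        + 2 * real m * (\<Sum>j=1..m. ?c j * ?d j)"
      unfolding sum.distrib sum_distrib_left[symmetric] by (simp add: star_coeff_outside)
    finally have *: "z * (\<Sum>j=1..m. ?c j *
        (real j * z ^ (j - 1) * (deriv ^^ j) \<eta> z + z ^ j * (deriv ^^ Suc j) \<eta> z)) = \<dots>" .
    \<comment> \<open>The sign in front of \<open>star\<close> alternates with m; this is the source
      of the minus sign before m/2.\<close>
    have s: "(-1::real) ^ m = - ((-1) ^ (m - 1))" using assms(2) by (cases m) auto
    have ring: "e * (r / 2 * B + 2 * r * A) = 2 * r * (e * A) - r / 2 * (- e * B)" for e r A B :: real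
      by (simp add: algebra_simps)
    have "z * ?D = (-1) ^ (m - 1) * (z * (\<Sum>j=1..m. ?c j *
        (real j * z ^ (j - 1) * (deriv ^^ j) \<eta> z + z ^ j * (deriv ^^ Suc j) \<eta> z)))"
      by (rule mult.left_commute)
    also note *
    also note ring
    finally show ?thesis unfolding star_def diff_Suc_1 s mult.assoc .
  qed
  then have "?D = (2 * real m * star \<eta> m z - real m / 2 * star \<eta> (Suc m) z) / z"
    using assms(3) by (simp add: eq_divide_eq mult.commute)
  ultimately show ?thesis by simp
qed

text \<open>The value of \<open>(-1)\<^sup>m h\<^sup>(\<^sup>m\<^sup>)\<close> at \<open>z\<^sup>2\<close>, for \<open>h(x) = \<eta>(\<surd>x)\<close> and \<open>z \<noteq> 0\<close>; for \<open>m \<ge> 1\<close> it is the junk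
  value \<open>0\<close> at \<open>z = 0\<close>.\<close>
definition cm_deriv :: "(real \<Rightarrow> real) \<Rightarrow> nat \<Rightarrow> real \<Rightarrow> real" where
  "cm_deriv \<eta> m z =
    (if m = 0 then \<eta> z else fact (m - 1) / (2 * 4 ^ (m - 1)) * star \<eta> m z / z ^ (2 * m))"

text \<open>This is the chain rule for h^(m)(z^2). Division by z^(2m) cancels the undifferentiated
  term in \<open>star_has_derivative\<close>, and the remaining factor m/4 turns the constant
  (m-1)!/(2*4^(m-1)) into the next one.\<close>

lemma cm_deriv_has_derivative:
  assumes "smooth \<eta>" "z \<noteq> 0"
  shows "(cm_deriv \<eta> m has_real_derivative - 2 * z * cm_deriv \<eta> (Suc m) z) (at z)"
proof (cases m)
  case 0
  \<comment> \<open>As c_{1,1} = -1, \<open>star \<eta> (Suc 0) z\<close> is -z times the derivative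
    of \<open>\<eta>\<close>; this fixes the factor 1/2 in \<open>cm_deriv\<close>.\<close>
  have "- 2 * z * cm_deriv \<eta> (Suc 0) z = deriv \<eta> z"
    using assms(2) by (simp add: cm_deriv_def star_def field_simps power2_eq_square)
  moreover have "cm_deriv \<eta> 0 = \<eta>" by (simp add: cm_deriv_def fun_eq_iff)
  ultimately show ?thesis using smooth_derivs[OF assms(1), of 0 z] 0 by simp
next
  case (Suc k)
  let ?K = "fact k / (2 * 4 ^ k) :: real" and ?S = "star \<eta> m z" and ?S' = "star \<eta> (Suc m) z"
  let ?D = "(?K * ((2 * real m * ?S - real m / 2 * ?S') / z) * z ^ (2 * m)
      - ?K * ?S * (real (2 * m) * z ^ (2 * m - 1))) / (z ^ (2 * m) * z ^ (2 * m))"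
  have "((\<lambda>z. ?K * star \<eta> m z / z ^ (2 * m)) has_real_derivative ?D) (at z)"
    using DERIV_divide[OF DERIV_cmult[OF star_has_derivative[OF assms(1) _ assms(2)], of m ?K]
        DERIV_pow[of "2 * m"]] assms(2) Suc by (simp only: One_nat_def) auto
  moreover have "cm_deriv \<eta> m = (\<lambda>z. ?K * star \<eta> m z / z ^ (2 * m))"
    using Suc by (simp add: cm_deriv_def fun_eq_iff)
  moreover have "?D = - 2 * z * cm_deriv \<eta> (Suc m) z"
  proof -
    have alg: "(K * ((2 * r * S - r / 2 * S') / z) * (z * P) - K * S * (2 * r * P)) / (z * P * (z * P))
        = - 2 * z * (K * r / 4 * S' / (z\<^sup>2 * (z * P)))" if "P \<noteq> 0" for K r S S' P :: real
      using assms(2) that by (simp add: field_simps power2_eq_square)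
    have p: "z ^ (2 * m) = z * z ^ (2 * m - 1)" "z ^ (2 * Suc m) = z\<^sup>2 * (z * z ^ (2 * m - 1))"
      using Suc by (simp_all add: power2_eq_square)
    have "?D = - 2 * z * (?K * real m / 4 * ?S' / (z\<^sup>2 * (z * z ^ (2 * m - 1))))"
      unfolding p(1) of_nat_mult of_nat_numeral by (rule alg) (use assms(2) in simp)
    also have "?K * real m / 4 = fact m / (2 * 4 ^ m)" unfolding Suc by simp
    also note p(2)[symmetric]
    finally show ?thesis using Suc by (simp add: cm_deriv_def)
  qed
  ultimately show ?thesis by simp
qed

lemma smooth_continuous: "smooth \<eta> \<Longrightarrow> continuous_on UNIV ((deriv ^^ j) \<eta>)"
  using smooth_derivs[of \<eta>] by (auto intro!: continuous_at_imp_continuous_on DERIV_isCont)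

lemma cm_deriv_measurable:
  assumes "smooth \<eta>"
  shows "cm_deriv \<eta> m \<in> borel_measurable borel"
proof -
  have [measurable]: "(deriv ^^ j) \<eta> \<in> borel_measurable borel" for j
    by (intro borel_measurable_continuous_onI smooth_continuous assms)
  have [measurable]: "\<eta> \<in> borel_measurable borel" using smooth_continuous[OF assms, of 0] by (simp add: borel_measurable_continuous_onI)
  show ?thesis unfolding cm_deriv_def star_def by measurable
qed

section \<open>Completely monotone chains on the half-line: decay, integration by parts, Taylor's
  formula\<close>

text \<open>The function \<open>q n\<close> stands for (-1)^n h^(n)(z^2). Sign and derivative are
  prescribed for z > 0 only, away from the default value of \<open>cm_deriv\<close> at 0.\<close>

locale cm_chain =
  fixes q :: "nat \<Rightarrow> real \<Rightarrow> real"
  assumes meas [measurable]: "q n \<in> borel_measurable borel"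
    and nonneg: "0 < z \<Longrightarrow> 0 \<le> q n z"
    and deriv: "0 < z \<Longrightarrow> (q n has_real_derivative - 2 * z * q (Suc n) z) (at z)"
    and vanish0: "(q 0 \<longlongrightarrow> 0) at_top"
begin

lemma antimono:
  assumes "0 < x" "x \<le> y"
  shows "q n y \<le> q n x"
proof (rule DERIV_nonpos_imp_nonincreasing[OF assms(2)])
  fix z assume "x \<le> z"
  then have "0 < z" using assms(1) by simp
  then show "\<exists>d. (q n has_real_derivative d) (at z) \<and> d \<le> 0"
    using deriv nonneg by (intro exI[of _ "- 2 * z * q (Suc n) z"]) simp
qed

text \<open>By induction: the mean value theorem on [z/2, z] and monotonicity bound
  \<open>q (Suc n) z\<close> by \<open>q n (z / 2)\<close>.\<close>

lemma vanish: "(q n \<longlongrightarrow> 0) at_top"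
proof (induction n)
  case 0
  show ?case by (rule vanish0)
next
  case (Suc n)
  have bound: "q (Suc n) z \<le> q n (z / 2)" if "2 \<le> z" for z
  proof -
    have "\<exists>u>z / 2. u < z \<and> q n z - q n (z / 2) = (z - z / 2) * (- 2 * u * q (Suc n) u)"
      by (rule MVT2) (use that deriv in auto)
    then obtain u where u: "z / 2 < u" "u < z" "q n z - q n (z / 2) = (z - z / 2) * (- 2 * u * q (Suc n) u)"
      by blast
    have "q (Suc n) z \<le> q (Suc n) u" using u that by (intro antimono) auto
    \<comment> \<open>The mean value identity carries the factor (z/2) * 2u = z u, which is at least
      1 because u > z/2 \<ge> 1.\<close>
    also have "\<dots> \<le> (z * u) * q (Suc n) u"
      using u that mult_mono[of 1 z 1 u] nonneg[of u "Suc n"]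
      by (intro mult_right_mono[of 1 "z * u", simplified]) auto
    also have "\<dots> = q n (z / 2) - q n z" using u(3) by (simp add: field_simps)
    also have "\<dots> \<le> q n (z / 2)" using nonneg[of z n] that by simp
    finally show ?thesis .
  qed
  have lim: "((\<lambda>z. q n (z / 2)) \<longlongrightarrow> 0) at_top"
    by (rule filterlim_compose[OF Suc]) real_asymp
  show ?case
  proof (rule tendsto_sandwich[OF _ _ tendsto_const lim])
    show "\<forall>\<^sub>F z in at_top. 0 \<le> q (Suc n) z"
      using eventually_gt_at_top[of 0] by eventually_elim (rule nonneg)
    show "\<forall>\<^sub>F z in at_top. q (Suc n) z \<le> q n (z / 2)"
      using eventually_ge_at_top[of 2] by eventually_elim (rule bound)
  qed
qed

text \<open>The fundamental theorem of calculus, with the boundary value at infinity supplied by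
  \<open>vanish\<close>.\<close>

lemma tail_integral:
  assumes "0 < z"
  shows "(\<integral>\<^sup>+u. ennreal (2 * u * q (Suc n) u) * indicator {z..} u \<partial>lborel) = ennreal (q n z)"
proof -
  have "(\<integral>\<^sup>+u. ennreal (2 * u * q (Suc n) u) * indicator {z..} u \<partial>lborel) = ennreal (0 - (- q n z))"
  proof (rule nn_integral_FTC_atLeast)
    show "((\<lambda>z. - q n z) \<longlongrightarrow> 0) at_top" using tendsto_minus[OF vanish[of n]] by simp
    fix u assume "z \<le> u"
    then show "((\<lambda>z. - q n z) has_real_derivative 2 * u * q (Suc n) u) (at u)"
      using assms deriv[of u n] by (auto intro!: derivative_eq_intros)
    show "0 \<le> 2 * u * q (Suc n) u" using \<open>z \<le> u\<close> assms nonneg[of u] by simp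
  qed simp
  then show ?thesis by simp
qed

text \<open>Tonelli's theorem applied to \<open>q\<^sub>n(x) = \<integral>\<^sub>x\<^sup>\<infinity> 2u q\<^sub>n\<^sub>+\<^sub>1(u) du\<close>; no boundary terms need controlling.\<close>
lemma integrate_by_parts:
  assumes a: "0 \<le> a"
    and [measurable]: "w \<in> borel_measurable borel"
    and w: "\<And>x. a \<le> x \<Longrightarrow> 0 \<le> w x"
    and W: "\<And>x. a \<le> x \<Longrightarrow> (W has_real_derivative w x) (at x)" "W a = 0"
  shows "(\<integral>\<^sup>+x. ennreal (w x * q n x) * indicator {a<..} x \<partial>lborel)
    = (\<integral>\<^sup>+u. ennreal (W u * (2 * u * q (Suc n) u)) * indicator {a<..} u \<partial>lborel)"
proof -
  define f where "f x u = ennreal (w x) * ennreal (2 * u * q (Suc n) u)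
    * (indicator {a<..} x * indicator {x..} u)" for x u :: real
  have f_meas: "case_prod f \<in> borel_measurable (lborel \<Otimes>\<^sub>M lborel)"
  proof -
    \<comment> \<open>Written as one condition on the pair, the region a < x \<le> u is visibly
      measurable.\<close>
    have "case_prod f = (\<lambda>(x, u). if a < x \<and> x \<le> u then ennreal (w x) * ennreal (2 * u * q (Suc n) u) else 0)"
      by (auto simp: f_def fun_eq_iff indicator_def)
    then show ?thesis by simp
  qed
  have "(\<integral>\<^sup>+x. ennreal (w x * q n x) * indicator {a<..} x \<partial>lborel)
    = (\<integral>\<^sup>+x. (\<integral>\<^sup>+u. f x u \<partial>lborel) \<partial>lborel)"
  proof (rule nn_integral_cong)
    fix x :: real
    show "ennreal (w x * q n x) * indicator {a<..} x = (\<integral>\<^sup>+u. f x u \<partial>lborel)"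
    proof (cases "a < x")
      case True
      have "(\<integral>\<^sup>+u. f x u \<partial>lborel)
        = (\<integral>\<^sup>+u. ennreal (w x) * (ennreal (2 * u * q (Suc n) u) * indicator {x..} u) \<partial>lborel)"
        using True by (intro nn_integral_cong) (simp add: f_def mult.assoc)
      also have "\<dots> = ennreal (w x) * ennreal (q n x)"
        using True a by (subst nn_integral_cmult) (simp_all add: tail_integral)
      finally show ?thesis using True w[of x] by (simp add: ennreal_mult')
    qed (simp add: f_def)
  qed
  also have "\<dots> = (\<integral>\<^sup>+u. (\<integral>\<^sup>+x. f x u \<partial>lborel) \<partial>lborel)"
    by (rule lborel_pair.Fubini'[symmetric]) (rule f_meas)
  also have "\<dots> = (\<integral>\<^sup>+u. ennreal (W u * (2 * u * q (Suc n) u)) * indicator {a<..} u \<partial>lborel)"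
  proof (rule nn_integral_cong)
    fix u :: real
    show "(\<integral>\<^sup>+x. f x u \<partial>lborel) = ennreal (W u * (2 * u * q (Suc n) u)) * indicator {a<..} u"
    proof (cases "a < u")
      case True
      have "(\<integral>\<^sup>+x. f x u \<partial>lborel)
        = (\<integral>\<^sup>+x. ennreal (2 * u * q (Suc n) u) * (ennreal (w x) * indicator {a..u} x) \<partial>lborel)"
        \<comment> \<open>Only the null point x = a is added, to obtain the compact interval on
          which \<open>W\<close> serves as primitive.\<close>
        by (rule nn_integral_cong_AE[OF AE_mp[OF AE_lborel_singleton[of a]]])
          (auto simp: f_def indicator_def mult.commute)
      also have "\<dots> = ennreal (2 * u * q (Suc n) u) * ennreal (W u - W a)"
        using True w W by (subst nn_integral_cmult, simp)
          (subst nn_integral_FTC_Icc[where F = W], auto intro: has_field_derivative_at_within)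
      also have "\<dots> = ennreal (W u * (2 * u * q (Suc n) u))"
        using True a nonneg[of u "Suc n"] W(2) by (simp add: ennreal_mult'[symmetric] mult.commute[of "W u"])
      finally show ?thesis using True by simp
    qed (auto simp: f_def indicator_def intro!: nn_integral_zero' AE_I2)
  qed
  finally show ?thesis .
qed

text \<open>Integration by parts with weight x^k from 0. Iterated, it expresses moments of
  \<open>q n\<close> through those of \<open>q 0\<close>.\<close>

lemma moment_Suc:
  "(\<integral>\<^sup>+u. ennreal (u ^ (k + 2) * q (Suc n) u) * indicator {0<..} u \<partial>lborel)
    = ennreal ((real k + 1) / 2) * (\<integral>\<^sup>+x. ennreal (x ^ k * q n x) * indicator {0<..} x \<partial>lborel)"
proof -
  have "(\<integral>\<^sup>+x. ennreal (x ^ k * q n x) * indicator {0<..} x \<partial>lborel)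
    = (\<integral>\<^sup>+u. ennreal (u ^ Suc k / (real k + 1) * (2 * u * q (Suc n) u)) * indicator {0<..} u \<partial>lborel)"
  proof (rule integrate_by_parts)
    fix x :: real
    show "((\<lambda>u. u ^ Suc k / (real k + 1)) has_real_derivative x ^ k) (at x)"
      by (rule derivative_eq_intros refl | simp add: add.commute)+
  qed auto
  then have "ennreal ((real k + 1) / 2) * (\<integral>\<^sup>+x. ennreal (x ^ k * q n x) * indicator {0<..} x \<partial>lborel)
    = (\<integral>\<^sup>+u. ennreal ((real k + 1) / 2) * (ennreal (u ^ Suc k / (real k + 1) * (2 * u * q (Suc n) u))
        * indicator {0<..} u) \<partial>lborel)"
    by (simp add: nn_integral_cmult)
  also have "\<dots> = (\<integral>\<^sup>+u. ennreal (u ^ (k + 2) * q (Suc n) u) * indicator {0<..} u \<partial>lborel)"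
  proof (intro nn_integral_cong)
    fix u :: real
    have "r / 2 * (u ^ Suc k / r * (2 * u * v)) = u ^ (k + 2) * v" if "0 < r" for r v :: real
      using that by simp
    from this[of "real k + 1" "q (Suc n) u"]
    have eq: "(real k + 1) / 2 * (u ^ Suc k / (real k + 1) * (2 * u * q (Suc n) u))
      = u ^ (k + 2) * q (Suc n) u" by linarith
    have mul: "ennreal ((real k + 1) / 2) * (ennreal V * i) = ennreal ((real k + 1) / 2 * V) * i" for V i
      by (subst ennreal_mult') (simp_all add: mult.assoc)
    show "ennreal ((real k + 1) / 2) * (ennreal (u ^ Suc k / (real k + 1) * (2 * u * q (Suc n) u))
      * indicator {0<..} u) = ennreal (u ^ (k + 2) * q (Suc n) u) * indicator {0<..} u"
      unfolding mul eq ..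
  qed
  finally show ?thesis by simp
qed

text \<open>Taylor's formula with integral remainder, expanded at infinity in the variable \<open>u\<^sup>2\<close>.\<close>
lemma taylor_at_top:
  assumes "0 < y"
  shows "(\<integral>\<^sup>+u. ennreal (2 * u * (u\<^sup>2 - y\<^sup>2) ^ n / fact n * q (Suc n) u) * indicator {y<..} u \<partial>lborel)
    = ennreal (q 0 y)"
proof (induction n)
  case 0
  have "(\<integral>\<^sup>+u. ennreal (2 * u * q (Suc 0) u) * indicator {y<..} u \<partial>lborel)
      = (\<integral>\<^sup>+u. ennreal (2 * u * q (Suc 0) u) * indicator {y..} u \<partial>lborel)"
    by (rule nn_integral_cong_AE[OF AE_mp[OF AE_lborel_singleton[of y]]]) (auto simp: indicator_def)
  then show ?case using assms by (simp add: tail_integral)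
next
  case (Suc n)
  have "(\<integral>\<^sup>+u. ennreal (2 * u * (u\<^sup>2 - y\<^sup>2) ^ n / fact n * q (Suc n) u) * indicator {y<..} u \<partial>lborel)
    = (\<integral>\<^sup>+u. ennreal ((u\<^sup>2 - y\<^sup>2) ^ Suc n / fact (Suc n) * (2 * u * q (Suc (Suc n)) u))
        * indicator {y<..} u \<partial>lborel)"
  proof (rule integrate_by_parts)
    fix x assume "y \<le> x"
    then show "0 \<le> 2 * x * (x\<^sup>2 - y\<^sup>2) ^ n / fact n" using assms by (simp add: power_mono)
    show "((\<lambda>u. (u\<^sup>2 - y\<^sup>2) ^ Suc n / fact (Suc n)) has_real_derivative
      2 * x * (x\<^sup>2 - y\<^sup>2) ^ n / fact n) (at x)"
    proof -
      have "((\<lambda>u. (u\<^sup>2 - y\<^sup>2) ^ Suc n) has_real_derivative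
        real (Suc n) * (x\<^sup>2 - y\<^sup>2) ^ n * (2 * x)) (at x)"
        using DERIV_power[of "\<lambda>u. u\<^sup>2 - y\<^sup>2" "2 * x" x UNIV "Suc n"]
        by (auto intro!: derivative_eq_intros simp: mult_ac simp del: of_nat_Suc power_Suc)
      from DERIV_cdivide[OF this, of "fact (Suc n)"] show ?thesis
        by (simp add: mult_ac del: of_nat_Suc power_Suc)
    qed
  qed (use assms in auto)
  then show ?case using Suc by (simp add: mult_ac)
qed

end

section \<open>Bounds for the Taylor kernel, uniform in its order, and its limit\<close>

text \<open>Combines 1 - t \<le> 1/(1 + t) with Bernoulli's inequality. It serves for small values w
  of the rescaled variable, with t proportional to 1/w^2.\<close>

lemma power_max_le:
  fixes t :: real
  assumes "0 < t" "0 < n"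
  shows "max 0 (1 - t) ^ n \<le> 1 / (real n * t)"
proof -
  have "max 0 (1 - t) \<le> 1 / (1 + t)"
    using assms by (auto simp: field_simps max_def)
  then have "max 0 (1 - t) ^ n \<le> (1 / (1 + t)) ^ n" by (rule power_mono) simp
  also have "\<dots> = 1 / (1 + t) ^ n" by (simp add: power_one_over)
  also have "\<dots> \<le> 1 / (real n * t)"
  proof (rule divide_left_mono)
    show "real n * t \<le> (1 + t) ^ n" using Bernoulli_inequality[of t n] assms by simp
  qed (use assms in auto)
  finally show ?thesis .
qed

text \<open>Up to a constant factor, \<open>b w / w\<close> is the Taylor kernel in the variable w =
  x / sqrt(2(n+1)). The bound is uniform in n. For w^2 \<ge> 1/2 it is a Lipschitz estimate; for
  smaller w the right side stays away from 0, so boundedness suffices.\<close>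

lemma kernel_lipschitz:
  fixes c w :: real
  assumes c: "0 < c" and n: "0 < n" and w: "0 < w"
  defines "b \<equiv> \<lambda>w. max 0 (1 - c / (real (Suc n) * w\<^sup>2)) ^ n"
  shows "\<bar>b w / w - b 1\<bar> \<le> (4 * c + 2 + 4 / c) * \<bar>w\<^sup>2 - 1\<bar>"
proof -
  have b01: "0 \<le> b v" "b v \<le> 1" for v
    using c by (auto simp: b_def intro!: power_le_one)
  show ?thesis
  proof (cases "w\<^sup>2 \<ge> 1 / 2")
    case True
    have w2: "1 / 2 \<le> w"
    proof (rule power2_le_imp_le)
      show "(1 / 2)\<^sup>2 \<le> w\<^sup>2" using True by (simp add: power2_eq_square)
    qed (use w in simp)
    \<comment> \<open>On [0, 1] the n-th power is Lipschitz with constant n, which the factor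
      1/(n+1) in the base compensates.\<close>
    have "\<bar>b w - b 1\<bar> \<le> real n * \<bar>max 0 (1 - c / (real (Suc n) * w\<^sup>2)) - max 0 (1 - c / (real (Suc n) * 1\<^sup>2))\<bar>"
      unfolding b_def real_norm_def[symmetric] by (rule norm_power_diff) (use c in auto)
    also have "\<dots> \<le> real n * \<bar>c / (real (Suc n) * w\<^sup>2) - c / real (Suc n)\<bar>"
      by (intro mult_left_mono) auto
    also have "\<dots> = (real n / real (Suc n)) * (c * (\<bar>w\<^sup>2 - 1\<bar> / w\<^sup>2))"
    proof -
      have "c / (r * v) - c / r = c / r * ((1 - v) / v)" if "0 < r" "0 < v" for r v :: real
        using that by (simp add: field_simps)
      then have "c / (real (Suc n) * w\<^sup>2) - c / real (Suc n) = c / real (Suc n) * ((1 - w\<^sup>2) / w\<^sup>2)"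
        using w by simp
      then show ?thesis using c by (simp add: abs_mult abs_minus_commute)
    qed
    also have "\<dots> \<le> 1 * (c * (\<bar>w\<^sup>2 - 1\<bar> * 2))"
    proof -
      have "\<bar>w\<^sup>2 - 1\<bar> / w\<^sup>2 \<le> \<bar>w\<^sup>2 - 1\<bar> / (1 / 2)"
        by (rule divide_left_mono) (use True w in auto)
      then show ?thesis using c by (intro mult_mono) auto
    qed
    finally have bd: "\<bar>b w - b 1\<bar> \<le> 2 * c * \<bar>w\<^sup>2 - 1\<bar>" by simp
    have ad: "\<bar>1 / w - 1\<bar> \<le> 2 * \<bar>w\<^sup>2 - 1\<bar>"
    proof -
      have eq: "1 / w - 1 = (1 - w\<^sup>2) * (1 / (w * (1 + w)))"
      proof -
        have "w \<noteq> 0" "1 + w \<noteq> 0" using w by auto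
        then show ?thesis by (simp add: divide_simps) (simp add: algebra_simps power2_eq_square)
      qed
      have "1 / (w * (1 + w)) \<le> 2"
        using w2 w mult_mono[of "1 / 2" w 1 "1 + w"] by (simp add: field_simps)
      then have "\<bar>1 - w\<^sup>2\<bar> * (1 / (w * (1 + w))) \<le> \<bar>1 - w\<^sup>2\<bar> * 2"
        by (rule mult_left_mono) simp
      then show ?thesis unfolding eq using w by (simp add: abs_mult abs_minus_commute)
    qed
    have "b w / w - b 1 = (b w - b 1) * (1 / w) + b 1 * (1 / w - 1)"
      using w by (simp add: field_simps)
    then have "\<bar>b w / w - b 1\<bar> \<le> \<bar>b w - b 1\<bar> * (1 / w) + b 1 * \<bar>1 / w - 1\<bar>"
      using abs_triangle_ineq[of "(b w - b 1) * (1 / w)" "b 1 * (1 / w - 1)"] w b01(1)[of 1]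
      by (simp add: abs_mult)
    also have "\<dots> \<le> (2 * c * \<bar>w\<^sup>2 - 1\<bar>) * 2 + 1 * (2 * \<bar>w\<^sup>2 - 1\<bar>)"
    proof (intro add_mono mult_mono)
      show "1 / w \<le> 2" using w2 w by (simp add: field_simps)
    qed (use bd ad b01 w c in auto)
    also have "\<dots> = (4 * c + 2) * \<bar>w\<^sup>2 - 1\<bar>" by (simp add: algebra_simps)
    also have "\<dots> \<le> (4 * c + 2 + 4 / c) * \<bar>w\<^sup>2 - 1\<bar>"
      using c by (intro mult_right_mono) auto
    finally show ?thesis .
  next
    case False
    have w1: "w \<le> 1" by (rule power2_le_imp_le) (use False in auto)
    \<comment> \<open>The resulting bound is of order w^2 and outweighs the singular factor
      1/w.\<close>
    have "b w \<le> 1 / (real n * (c / (real (Suc n) * w\<^sup>2)))"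
      unfolding b_def by (rule power_max_le) (use c n w in auto)
    also have "\<dots> = (real (Suc n) / real n) * (w\<^sup>2 / c)" using c n w by simp
    also have "\<dots> \<le> 2 * (w\<^sup>2 / c)"
      using n c by (intro mult_right_mono) (auto simp: field_simps)
    finally have "b w / w \<le> 2 * (w\<^sup>2 / c) / w" using w by (intro divide_right_mono) auto
    also have "\<dots> = 2 * w / c" using w by (simp add: power2_eq_square)
    also have "\<dots> \<le> 2 / c" using w1 c by (intro divide_right_mono) auto
    finally have "b w / w \<le> 2 / c" .
    moreover have "0 \<le> b w / w" using b01 w by simp
    ultimately have "\<bar>b w / w - b 1\<bar> \<le> 2 / c + 1"
      using b01[of 1] c by (auto simp: abs_le_iff)
    \<comment> \<open>In this case the distance from w^2 to 1 exceeds 1/2; hence the term 4/c in the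
      constant.\<close>
    also have "\<dots> = (2 + 4 / c) * (1 / 2)" by (simp add: field_simps)
    also have "\<dots> \<le> (4 * c + 2 + 4 / c) * \<bar>w\<^sup>2 - 1\<bar>"
      using False c by (intro mult_mono) auto
    finally show ?thesis .
  qed
qed

text \<open>The sequence is the reciprocal of the Gauss product for Gamma(1/2) = sqrt pi at index
  n+1, divided by sqrt 2. This is how the Gaussian normalisation arises.\<close>

lemma normalization_limit:
  "(\<lambda>n. pochhammer (1 / 2) (Suc n) / (fact n * sqrt (2 * real (Suc n)))) \<longlonglongrightarrow> 1 / sqrt (2 * pi)"
proof -
  have "(\<lambda>n. 1 / (sqrt 2 * Gamma_series' (1 / 2) (Suc n))) \<longlonglongrightarrow> 1 / (sqrt 2 * Gamma (1 / 2 :: real))"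
    by (intro tendsto_intros LIMSEQ_Suc[OF Gamma_series'_LIMSEQ])
      (simp add: Gamma_one_half_real)
  moreover have "1 / (sqrt 2 * Gamma_series' (1 / 2) (Suc n))
      = pochhammer (1 / 2) (Suc n) / (fact n * sqrt (2 * real (Suc n)))" for n
  proof -
    have "exp (1 / 2 * ln (real (Suc n))) = sqrt (real (Suc n))"
      by (simp add: powr_half_sqrt[symmetric] powr_def)
    then show ?thesis by (simp add: Gamma_series'_def real_sqrt_mult mult_ac del: of_nat_Suc)
  qed
  ultimately show ?thesis by (simp add: Gamma_one_half_real real_sqrt_mult)
qed

text \<open>The truncation at 0 is inactive for large n, so this is the usual limit for the
  exponential function.\<close>

lemma exp_limit_Suc:
  fixes c :: real
  shows "(\<lambda>n. max 0 (1 - c / real (Suc n)) ^ n) \<longlonglongrightarrow> exp (- c)"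
proof -
  have "(\<lambda>n. (1 - c / real (Suc n)) ^ n) \<longlonglongrightarrow> exp (- c)" by real_asymp
  moreover have "\<forall>\<^sub>F n in sequentially. 0 \<le> 1 - c / real (Suc n)" by real_asymp
  then have "\<forall>\<^sub>F n in sequentially. (1 - c / real (Suc n)) ^ n = max 0 (1 - c / real (Suc n)) ^ n"
    by eventually_elim (simp add: max_def)
  ultimately show ?thesis by (rule Lim_transform_eventually)
qed

section \<open>Moments of the weighted chain and convergence to the Gaussian density\<close>

context cm_chain
begin

text \<open>The constants are halves of 1, 1 and 3, the total mass and the moments of order 2 and 4
  of a symmetric density on the whole line.\<close>

context
  assumes m0: "(\<integral>\<^sup>+x. ennreal (q 0 x) * indicator {0<..} x \<partial>lborel) = ennreal (1 / 2)"
    and m2: "(\<integral>\<^sup>+x. ennreal (x\<^sup>2 * q 0 x) * indicator {0<..} x \<partial>lborel) = ennreal (1 / 2)"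
    and m4: "(\<integral>\<^sup>+x. ennreal (x ^ 4 * q 0 x) * indicator {0<..} x \<partial>lborel) = ennreal (3 / 2)"
begin

text \<open>By \<open>moment_Suc\<close>, passing from n to n+1 multiplies a moment of exponent k by
  (k+1)/2. The ratios 2n+1 and (2n+1)(2n+3) are those of Gaussian moments, since the initial values
  are Gaussian.\<close>

lemma moments:
  defines "A \<equiv> \<lambda>n. pochhammer (1 / 2) n / 2 :: real"
  shows "(\<integral>\<^sup>+x. ennreal (x ^ (2 * n) * q n x) * indicator {0<..} x \<partial>lborel) = ennreal (A n)"
    and "(\<integral>\<^sup>+x. ennreal (x ^ (2 * n + 2) * q n x) * indicator {0<..} x \<partial>lborel)
      = ennreal (A n * (2 * real n + 1))"
    and "(\<integral>\<^sup>+x. ennreal (x ^ (2 * n + 4) * q n x) * indicator {0<..} x \<partial>lborel)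
      = ennreal (A n * (2 * real n + 1) * (2 * real n + 3))"
proof (induction n)
  case 0
  { case 1 then show ?case using m0 by (simp add: A_def) }
  { case 2 then show ?case using m2 by (simp add: A_def power2_eq_square) }
  { case 3 then show ?case using m4 by (simp add: A_def) }
next
  case (Suc n)
  have A: "0 \<le> A n" "A (Suc n) = (real (2 * n) + 1) / 2 * A n"
    by (simp_all add: A_def pochhammer_Suc pochhammer_nonneg field_simps)
  have step: "(\<integral>\<^sup>+x. ennreal (x ^ (2 * Suc n + j) * q (Suc n) x) * indicator {0<..} x \<partial>lborel)
      = ennreal C"
    if "(\<integral>\<^sup>+x. ennreal (x ^ (2 * n + j) * q n x) * indicator {0<..} x \<partial>lborel) = ennreal B"
      "C = (real (2 * n + j) + 1) / 2 * B" for j B C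
  proof -
    have e: "2 * Suc n + j = (2 * n + j) + 2" by simp
    show ?thesis unfolding e moment_Suc that by (rule ennreal_mult'[symmetric]) simp
  qed
  { case 1 show ?case
      using step[of 0 "A n" "A (Suc n)"] Suc(1) A(2) by (simp only: add_0_right) }
  { case 2 show ?case
      by (rule step[OF Suc(2)]) (simp add: A(2) field_simps) }
  { case 3 show ?case
      by (rule step[OF Suc(3)]) (simp add: A(2) field_simps) }
qed

text \<open>Bochner integrals are used from here on because the error estimate subtracts
  integrals.\<close>

lemma has_integral_moments:
  defines "A \<equiv> \<lambda>n. pochhammer (1 / 2) n / 2 :: real"
    and "F \<equiv> \<lambda>n x. x ^ (2 * n) * q n x * indicator {0<..} x"
  shows "has_bochner_integral lborel (F n) (A n)"
    and "has_bochner_integral lborel (\<lambda>x. x\<^sup>2 * F n x) (A n * (2 * real n + 1))"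
    and "has_bochner_integral lborel (\<lambda>x. x ^ 4 * F n x) (A n * (2 * real n + 1) * (2 * real n + 3))"
proof -
  have *: "has_bochner_integral lborel (\<lambda>x. x ^ k * F n x) B"
    if "(\<integral>\<^sup>+x. ennreal (x ^ (2 * n + k) * q n x) * indicator {0<..} x \<partial>lborel) = ennreal B" "0 \<le> B" for k B
  proof (rule has_bochner_integral_nn_integral)
    show "AE x in lborel. 0 \<le> x ^ k * F n x"
      using nonneg by (auto simp: F_def indicator_def)
    show "(\<integral>\<^sup>+x. ennreal (x ^ k * F n x) \<partial>lborel) = ennreal B"
      unfolding that(1)[symmetric]
      by (intro nn_integral_cong) (auto simp: F_def indicator_def power_add mult_ac)
  qed (use that in \<open>auto simp: F_def\<close>)
  have A: "0 \<le> A n" by (simp add: A_def pochhammer_nonneg)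
  show "has_bochner_integral lborel (F n) (A n)"
    using *[of 0 "A n"] moments(1)[of n] A by (simp add: A_def)
  show "has_bochner_integral lborel (\<lambda>x. x\<^sup>2 * F n x) (A n * (2 * real n + 1))"
    using A moments(2)[of n] by (intro *) (auto simp: A_def)
  show "has_bochner_integral lborel (\<lambda>x. x ^ 4 * F n x) (A n * (2 * real n + 1) * (2 * real n + 3))"
    using A moments(3)[of n] by (intro *) (auto simp: A_def)
qed

text \<open>Under the probability density proportional to \<open>x\<^sup>2\<^sup>N q\<^sub>N(x)\<close> the variable
  \<open>x\<^sup>2/(2N)\<close> has mean \<open>1 + O(1/N)\<close> and variance \<open>O(1/N)\<close>, so the Taylor kernel may be
  evaluated at \<open>x\<^sup>2 = 2N\<close>.\<close>
lemma kernel_estimate: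
  fixes y :: real and n :: nat
  assumes y: "0 < y" and n: "0 < n"
  defines "c \<equiv> y\<^sup>2 / 2" and "N \<equiv> Suc n"
  defines "a \<equiv> pochhammer (1 / 2) N / (fact n * sqrt (2 * real N))"
  shows "\<bar>q 0 y - a * max 0 (1 - c / real N) ^ n\<bar>
    \<le> a * (4 * c + 2 + 4 / c) * (3 / (2 * sqrt (real N)))"
proof -
  define A where "A = (pochhammer (1 / 2) N / 2 :: real)"
  define F where "F x = x ^ (2 * N) * q N x * indicator {0<..} x" for x
  \<comment> \<open>The measure concentrates at \<open>s\<close>; \<open>r\<close> is the weight for
    Young's inequality. \<open>H\<close> is the Taylor integrand factored into \<open>F\<close>, the
    prefactor \<open>B\<close> and the rescaled kernel, so its value at x = \<open>s\<close> is
    governed by \<open>b 1\<close>.\<close>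
  define s where "s = sqrt (2 * real N)"
  define r where "r = sqrt (real N)"
  define K where "K = 4 * c + 2 + 4 / c"
  define B where "B = 2 / (fact n * s)"
  define b where "b w = max 0 (1 - c / (real N * w\<^sup>2)) ^ n" for w
  define H where "H x = F x * (B * (b (x / s) / (x / s)))" for x
  have s: "0 < s" "s\<^sup>2 = 2 * real N" by (simp_all add: s_def N_def)
  have r: "0 < r" "r\<^sup>2 = real N" by (simp_all add: r_def N_def)
  have c: "0 < c" using y by (simp add: c_def)
  have K: "0 < K" using c by (simp add: K_def add_pos_pos)
  have B: "0 < B" using s by (simp add: B_def)
  have A: "0 \<le> A" by (simp add: A_def pochhammer_nonneg)
  have a: "a = A * B" by (simp add: a_def A_def B_def s_def)
  have F0: "0 \<le> F x" for x using nonneg by (auto simp: F_def indicator_def)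
  have F1: "has_bochner_integral lborel F A"
    and F2: "has_bochner_integral lborel (\<lambda>x. x\<^sup>2 * F x) (A * (2 * real N + 1))"
    and F4: "has_bochner_integral lborel (\<lambda>x. x ^ 4 * F x) (A * (2 * real N + 1) * (2 * real N + 3))"
    using has_integral_moments[of N] by (simp_all add: F_def[abs_def] A_def)
  have H: "has_bochner_integral lborel H (q 0 y)"
  proof (rule has_bochner_integral_nn_integral)
    show "H \<in> borel_measurable lborel" unfolding H_def F_def b_def by measurable
    show "AE x in lborel. 0 \<le> H x"
      using F0 B s by (intro AE_I2) (auto simp: H_def F_def indicator_def b_def nonneg)
    show "0 \<le> q 0 y" by (rule nonneg[OF y])
    show "(\<integral>\<^sup>+x. ennreal (H x) \<partial>lborel) = ennreal (q 0 y)"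
      unfolding taylor_at_top[OF y, of n, symmetric]
    proof (intro nn_integral_cong)
      fix x :: real
      have e: "c / (real N * (x / s)\<^sup>2) = y\<^sup>2 / x\<^sup>2"
        using s by (simp add: c_def power_divide N_def del: of_nat_Suc)
      consider "x \<le> 0" | "0 < x" "x \<le> y" | "y < x" by linarith
      then show "ennreal (H x) = ennreal (2 * x * (x\<^sup>2 - y\<^sup>2) ^ n / fact n * q (Suc n) x) * indicator {y<..} x"
      proof cases
        case 1
        then show ?thesis using y by (simp add: H_def F_def)
      next
        case 2
        then have "1 \<le> y\<^sup>2 / x\<^sup>2" by (simp add: power_mono)
        \<comment> \<open>The truncation gives 0 to the power n, which is 0 because n > 0; this
          restricts the integral to x > y.\<close>
        then have "b (x / s) = 0" unfolding b_def e using n by (simp add: max_def)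
        then show ?thesis using 2 by (simp add: H_def)
      next
        case 3
        then have "0 < x" using y by simp
        have "y\<^sup>2 / x\<^sup>2 \<le> 1" using 3 y by (simp add: power_mono)
        then have "b (x / s) = (1 - y\<^sup>2 / x\<^sup>2) ^ n" unfolding b_def e by simp
        also have "\<dots> = ((x\<^sup>2 - y\<^sup>2) / x\<^sup>2) ^ n"
          using \<open>0 < x\<close> by (simp add: diff_divide_distrib)
        also have "\<dots> = (x\<^sup>2 - y\<^sup>2) ^ n / x ^ (2 * n)" by (simp add: power_divide power_mult)
        finally have "H x = 2 * x * (x\<^sup>2 - y\<^sup>2) ^ n / fact n * q (Suc n) x"
          using \<open>0 < x\<close> s(1) by (simp add: H_def F_def B_def N_def field_simps)
        then show ?thesis using 3 by simp
      qed
    qed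
  qed
  \<comment> \<open>The majorant is B K F(x) (1/r + r t^2)/2 with t = x^2/(2N) - 1, expanded so that
    its integral involves only the three known moments.\<close>
  define U where "U x = B * K / 2 * ((1 / r + r) * F x - r / real N * (x\<^sup>2 * F x)
      + r / (4 * real N ^ 2) * (x ^ 4 * F x))" for x
  have U: "has_bochner_integral lborel U (B * K / 2 * ((1 / r + r) * A - r / real N * (A * (2 * real N + 1))
      + r / (4 * real N ^ 2) * (A * (2 * real N + 1) * (2 * real N + 3))))"
    unfolding U_def
    by (intro has_bochner_integral_add has_bochner_integral_diff has_bochner_integral_mult_right F1 F2 F4)
  have D: "has_bochner_integral lborel (\<lambda>x. H x - B * b 1 * F x) (q 0 y - B * b 1 * A)"
    by (intro has_bochner_integral_diff has_bochner_integral_mult_right H F1)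
  have pw: "\<bar>H x - B * b 1 * F x\<bar> \<le> U x" for x
  proof (cases "0 < x")
    case True
    let ?t = "(x / s)\<^sup>2 - 1"
    have "\<bar>b (x / s) / (x / s) - b 1\<bar> \<le> K * \<bar>?t\<bar>"
      using kernel_lipschitz[OF c n, of "x / s"] True s unfolding b_def K_def N_def by simp
    \<comment> \<open>Young's inequality replaces the absolute value by a polynomial. The choice r =
      sqrt N balances the two terms, as t^2 has mean of order 1/N.\<close>
    also have "\<bar>?t\<bar> \<le> (1 / r + r * ?t\<^sup>2) / 2"
    proof -
      have "0 \<le> (1 / r) * (1 - r * \<bar>?t\<bar>)\<^sup>2" using r by simp
      also have "\<dots> = 1 / r - 2 * \<bar>?t\<bar> + r * \<bar>?t\<bar>\<^sup>2"
        using r by (simp add: power2_eq_square field_simps)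
      finally show ?thesis by simp
    qed
    finally have *: "\<bar>b (x / s) / (x / s) - b 1\<bar> \<le> K * ((1 / r + r * ?t\<^sup>2) / 2)"
      using K by simp
    have "\<bar>H x - B * b 1 * F x\<bar> = B * F x * \<bar>b (x / s) / (x / s) - b 1\<bar>"
    proof -
      have "H x - B * b 1 * F x = B * F x * (b (x / s) / (x / s) - b 1)"
        by (simp add: H_def algebra_simps)
      then show ?thesis using B F0[of x] by (simp add: abs_mult)
    qed
    also have "\<dots> \<le> B * F x * (K * ((1 / r + r * ?t\<^sup>2) / 2))"
      using B F0[of x] * by (intro mult_left_mono) auto
    also have "\<dots> = U x"
    proof -
      have t: "?t = x\<^sup>2 / (2 * real N) - 1" using s by (simp add: power_divide)
      have "?t\<^sup>2 = 1 - x\<^sup>2 / real N + x ^ 4 / (4 * real N ^ 2)"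
      proof -
        have "(v / (2 * M) - 1)\<^sup>2 = 1 - v / M + v\<^sup>2 / (4 * M\<^sup>2)" if "0 < M" for v M :: real
          using that by (simp add: power2_eq_square field_simps)
        from this[of "real N" "x\<^sup>2"] show ?thesis unfolding t by (simp add: N_def)
      qed
      then show ?thesis unfolding U_def by (simp only:) (simp add: field_simps)
    qed
    finally show ?thesis .
  qed (simp add: H_def U_def F_def)
  have "\<bar>q 0 y - B * b 1 * A\<bar> = \<bar>\<integral>x. H x - B * b 1 * F x \<partial>lborel\<bar>"
    using has_bochner_integral_integral_eq[OF D] by simp
  also have "\<dots> \<le> (\<integral>x. \<bar>H x - B * b 1 * F x\<bar> \<partial>lborel)"
    by (rule integral_abs_bound)
  also have "\<dots> \<le> (\<integral>x. U x \<partial>lborel)"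
    using D U pw by (intro integral_mono integrable_abs) (auto simp: has_bochner_integral_iff)
  \<comment> \<open>The terms of order one cancel in the mean of t^2, leaving 1/N + 3/(4N^2). This
    is where the value 3 of the fourth moment forces concentration.\<close>
  also have "\<dots> = A * B * K / 2 * (1 / r + r * (1 / real N + 3 / (4 * real N ^ 2)))"
  proof -
    have "0 < real N" by (simp add: N_def)
    then show ?thesis unfolding has_bochner_integral_integral_eq[OF U]
      by (simp add: field_simps power2_eq_square)
  qed
  also have "\<dots> \<le> A * B * K / 2 * (1 / r + r * (1 / real N + 1 / real N))"
  proof -
    have "3 / (4 * real N ^ 2) \<le> 1 / real N"
    proof -
      have "3 / (4 * v\<^sup>2) \<le> 1 / v" if "1 \<le> v" for v :: real
        using that by (simp add: divide_simps power2_eq_square)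
      then show ?thesis by (simp add: N_def)
    qed
    then show ?thesis using A B K r by (intro mult_left_mono add_mono) auto
  qed
  also have "r * (1 / real N + 1 / real N) = 2 / r"
    using r(1) unfolding r(2)[symmetric] by (simp add: field_simps power2_eq_square)
  also have "A * B * K / 2 * (1 / r + 2 / r) = a * K * (3 / (2 * r))"
    by (simp add: a field_simps)
  finally show ?thesis
    by (simp add: a b_def K_def r_def mult_ac)
qed

text \<open>The main term of \<open>kernel_estimate\<close> converges both to the Gaussian density
  at y and, since the error is of order 1/sqrt N, to \<open>q 0 y\<close>.\<close>

lemma eq_std_normal_density:
  assumes y: "0 < y"
  shows "q 0 y = std_normal_density y"
proof -
  define c where "c = y\<^sup>2 / 2"
  define a where "a n = (pochhammer (1 / 2) (Suc n) / (fact n * sqrt (2 * real (Suc n))) :: real)" for n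
  define g where "g n = a n * max 0 (1 - c / real (Suc n)) ^ n" for n
  have a: "a \<longlonglongrightarrow> 1 / sqrt (2 * pi)" unfolding a_def[abs_def] by (rule normalization_limit)
  have "g \<longlonglongrightarrow> 1 / sqrt (2 * pi) * exp (- c)"
    unfolding g_def[abs_def] by (intro tendsto_mult a exp_limit_Suc)
  moreover have "g \<longlonglongrightarrow> q 0 y"
  proof (rule Lim_null_comparison[THEN LIM_zero_cancel])
    show "\<forall>\<^sub>F n in sequentially. norm (g n - q 0 y)
      \<le> a n * (4 * c + 2 + 4 / c) * (3 / (2 * sqrt (real (Suc n))))"
      using eventually_gt_at_top[of 0]
    proof eventually_elim
      case (elim n)
      show ?case using kernel_estimate[OF y elim]
        unfolding g_def a_def c_def by (simp only: real_norm_def abs_minus_commute)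
    qed
    have "(\<lambda>n. 3 / (2 * sqrt (real (Suc n)))) \<longlonglongrightarrow> 0" by real_asymp
    from tendsto_mult[OF tendsto_mult[OF a tendsto_const] this]
    show "(\<lambda>n. a n * (4 * c + 2 + 4 / c) * (3 / (2 * sqrt (real (Suc n))))) \<longlonglongrightarrow> 0"
      by simp
  qed
  ultimately have "q 0 y = 1 / sqrt (2 * pi) * exp (- c)" by (rule LIMSEQ_unique[rotated])
  then show ?thesis by (simp add: normal_density_def c_def)
qed

end

end

section \<open>Symmetry, even moments on the half-line, and identification of the density\<close>

text \<open>By symmetry the reflected density is also a density of \<open>Z\<close>, and densities
  are unique up to null sets.\<close>

lemma symmetric_density_AE_even:
  fixes \<eta> :: "real \<Rightarrow> real"
  assumes "prob_space M"
    and \<eta>: "\<And>z. 0 \<le> \<eta> z" "\<eta> \<in> borel_measurable borel"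
    and dist: "distributed M lborel Z (\<lambda>z. ennreal (\<eta> z))"
    and sym: "symmetric_rv M Z"
  shows "AE z in lborel. \<eta> (- z) = \<eta> z"
proof -
  interpret prob_space M by fact
  note [measurable] = \<eta>(2)
  have Z[measurable]: "Z \<in> borel_measurable M"
    using distributed_measurable[OF dist] by simp
  have Zd: "distr M borel Z = density lborel (\<lambda>z. ennreal (\<eta> z))"
    using distributed_distr_eq_density[OF dist] by (simp cong: distr_cong)
  have "density lborel (\<lambda>z. ennreal (\<eta> z)) = distr M borel (\<lambda>\<omega>. - Z \<omega>)"
    using sym Zd by (simp add: symmetric_rv_def)
  also have "\<dots> = distr (density lborel (\<lambda>z. ennreal (\<eta> z))) borel uminus"
    unfolding Zd[symmetric] by (simp add: distr_distr comp_def)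
  also have "\<dots> = density lborel (\<lambda>z. ennreal (\<eta> (- z)))"
  proof (rule measure_eqI)
    fix B assume "B \<in> sets (distr (density lborel (\<lambda>z. ennreal (\<eta> z))) borel uminus)"
    then have [measurable]: "B \<in> sets borel" by simp
    have "emeasure (distr (density lborel (\<lambda>z. ennreal (\<eta> z))) borel uminus) B
      = (\<integral>\<^sup>+z. ennreal (\<eta> z) * indicator B (- z) \<partial>lborel)"
    proof -
      have "uminus -` B \<in> sets borel"
        using measurable_sets_borel[of uminus borel B] by simp
      then show ?thesis
        by (simp add: emeasure_distr emeasure_density) (simp add: indicator_def vimage_def)
    qed
    also have "\<dots> = (\<integral>\<^sup>+z. ennreal (\<eta> (- z)) * indicator B z \<partial>lborel)"
      by (subst nn_integral_real_affine[where c = "-1" and t = 0]) simp_all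
    finally show "emeasure (distr (density lborel (\<lambda>z. ennreal (\<eta> z))) borel uminus) B
      = emeasure (density lborel (\<lambda>z. ennreal (\<eta> (- z)))) B"
      by (simp add: emeasure_density)
  qed simp
  finally have "density lborel (\<lambda>z. ennreal (\<eta> z)) = density lborel (\<lambda>z. ennreal (\<eta> (- z)))" .
  then have "distributed M lborel Z (\<lambda>z. ennreal (\<eta> (- z)))"
    using dist by (simp add: distributed_def)
  from distributed_unique[OF dist this]
  have "AE z in lborel. ennreal (\<eta> z) = ennreal (\<eta> (- z))" .
  then show ?thesis by eventually_elim (simp add: \<eta>(1))
qed

lemma half_line_integral:
  fixes f :: "real \<Rightarrow> real"
  assumes f: "f \<in> borel_measurable borel" "AE x in lborel. f (- x) = f x"
    and I: "(\<integral>\<^sup>+x. ennreal (f x) \<partial>lborel) = ennreal c" and c: "0 \<le> c"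
  shows "(\<integral>\<^sup>+x. ennreal (f x) * indicator {0<..} x \<partial>lborel) = ennreal (c / 2)"
proof -
  let ?P = "\<integral>\<^sup>+x. ennreal (f x) * indicator {0<..} x \<partial>lborel"
  note [measurable] = f(1)
  have "ennreal c = (\<integral>\<^sup>+x. (ennreal (f x) * indicator {0<..} x + ennreal (f x) * indicator {..<0} x) \<partial>lborel)"
    unfolding I[symmetric]
    by (rule nn_integral_cong_AE[OF AE_mp[OF AE_lborel_singleton[of 0]]]) (auto simp: indicator_def)
  also have "\<dots> = ?P + (\<integral>\<^sup>+x. ennreal (f x) * indicator {..<0} x \<partial>lborel)"
    by (rule nn_integral_add) simp_all
  also have "(\<integral>\<^sup>+x. ennreal (f x) * indicator {..<0} x \<partial>lborel)
      = (\<integral>\<^sup>+x. ennreal (f (- x)) * indicator {..<0} (- x) \<partial>lborel)"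
    by (subst nn_integral_real_affine[where c = "-1" and t = 0]) simp_all
  also have "\<dots> = ?P"
    by (rule nn_integral_cong_AE[OF AE_mp[OF f(2)]]) (auto simp: indicator_def)
  finally have e: "ennreal c = ?P + ?P" .
  then obtain p where p: "0 \<le> p" "?P = ennreal p" by (cases ?P) auto
  then have "c = p + p" using e c by (simp add: ennreal_plus[symmetric] del: ennreal_plus)
  then show ?thesis using p(2) by simp
qed

text \<open>For even k the power is nonnegative, so the passage to \<open>ennreal\<close> truncates
  nothing.\<close>

lemma distributed_moment:
  fixes \<eta> :: "real \<Rightarrow> real"
  assumes \<eta>: "\<And>z. 0 \<le> \<eta> z"
    and dist: "distributed M lborel Z (\<lambda>z. ennreal (\<eta> z))"
    and I: "integrable M (\<lambda>\<omega>. (Z \<omega>) ^ k)" "(LINT \<omega>|M. (Z \<omega>) ^ k) = c" and "even k"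
  shows "(\<integral>\<^sup>+z. ennreal (z ^ k * \<eta> z) \<partial>lborel) = ennreal c"
proof -
  have "(\<integral>\<^sup>+z. ennreal (z ^ k * \<eta> z) \<partial>lborel) = (\<integral>\<^sup>+z. ennreal (\<eta> z) * ennreal (z ^ k) \<partial>lborel)"
    using \<eta> by (intro nn_integral_cong) (simp add: ennreal_mult'[symmetric] mult.commute)
  also have "\<dots> = (\<integral>\<^sup>+\<omega>. ennreal ((Z \<omega>) ^ k) \<partial>M)"
    by (rule distributed_nn_integral[OF dist]) simp
  also have "\<dots> = ennreal c"
    using I nn_integral_eq_integral[OF I(1)] \<open>even k\<close> by (simp add: zero_le_even_power)
  finally show ?thesis .
qed

theorem theorem1p2p6:
  fixes M :: "'a measure" and Z :: "'a \<Rightarrow> real" and \<eta> :: "real \<Rightarrow> real"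
  assumes "prob_space M"
    and "\<And>z. 0 \<le> \<eta> z"
    and "distributed M lborel Z (\<lambda>z. ennreal (\<eta> z))"
    and "smooth \<eta>"
    and "symmetric_rv M Z"
    and "integrable M (\<lambda>\<omega>. (Z \<omega>) ^ 2)" and "(LINT \<omega>|M. (Z \<omega>) ^ 2) = 1"
    and "integrable M (\<lambda>\<omega>. (Z \<omega>) ^ 4)" and "(LINT \<omega>|M. (Z \<omega>) ^ 4) = 3"
    and "\<And>m z. 1 \<le> m \<Longrightarrow> 0 \<le> star \<eta> m z"
  shows "distributed M lborel Z (\<lambda>z. ennreal (std_normal_density z))"
proof -
  interpret prob_space M by fact
  note \<eta> = assms(2) and dist = assms(3) and smooth = assms(4)
  have q0: "cm_deriv \<eta> 0 = \<eta>" by (simp add: cm_deriv_def fun_eq_iff)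
  have meas[measurable]: "\<eta> \<in> borel_measurable borel"
    using cm_deriv_measurable[OF smooth, of 0] by (simp add: q0)
  have even: "AE z in lborel. \<eta> (- z) = \<eta> z"
    by (rule symmetric_density_AE_even[OF assms(1) \<eta> meas dist assms(5)])
  have half: "(\<integral>\<^sup>+x. ennreal (x ^ k * \<eta> x) * indicator {0<..} x \<partial>lborel) = ennreal (c / 2)"
    if "integrable M (\<lambda>\<omega>. (Z \<omega>) ^ k)" "(LINT \<omega>|M. (Z \<omega>) ^ k) = c" "even k" for k c
  proof (rule half_line_integral)
    show "(\<integral>\<^sup>+x. ennreal (x ^ k * \<eta> x) \<partial>lborel) = ennreal c"
      by (rule distributed_moment[OF \<eta> dist that])
    show "AE x in lborel. (- x) ^ k * \<eta> (- x) = x ^ k * \<eta> x"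
      using even by eventually_elim (use \<open>even k\<close> in simp)
    show "0 \<le> c" unfolding that(2)[symmetric] using \<open>even k\<close> by (intro integral_nonneg_AE) (simp add: zero_le_even_power)
  qed simp
  have m0: "(\<integral>\<^sup>+x. ennreal (\<eta> x) * indicator {0<..} x \<partial>lborel) = ennreal (1 / 2)"
    using half[of 0 1] by (simp add: prob_space)
  interpret q: cm_chain "cm_deriv \<eta>"
  proof
    show "cm_deriv \<eta> n \<in> borel_measurable borel" for n
      by (rule cm_deriv_measurable[OF smooth])
    show nn: "0 \<le> cm_deriv \<eta> n z" if "0 < z" for n z
      using that \<eta> assms(10)[of n z] by (simp add: cm_deriv_def)
    show der: "(cm_deriv \<eta> n has_real_derivative - 2 * z * cm_deriv \<eta> (Suc n) z) (at z)"
      if "0 < z" for n z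
      by (rule cm_deriv_has_derivative[OF smooth]) (use that in simp)
    show "(cm_deriv \<eta> 0 \<longlongrightarrow> 0) at_top"
    \<comment> \<open>As \<open>\<eta>\<close> is nonincreasing on the positive half-line and has
      mass 1/2 there, z times \<open>\<eta> z\<close> is at most 1/2.\<close>
    proof (rule tendsto_sandwich[OF _ _ tendsto_const])
      show "((\<lambda>z::real. 1 / (2 * z)) \<longlongrightarrow> 0) at_top" by real_asymp
      show "\<forall>\<^sub>F z in at_top. 0 \<le> cm_deriv \<eta> 0 z" by (simp add: q0 \<eta>)
      show "\<forall>\<^sub>F z in at_top. cm_deriv \<eta> 0 z \<le> 1 / (2 * z)"
        using eventually_gt_at_top[of 0]
      proof eventually_elim
        case (elim z)
        have anti: "\<eta> z \<le> \<eta> x" if "0 < x" "x \<le> z" for x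
        proof (rule DERIV_nonpos_imp_nonincreasing[OF that(2)])
          fix u assume "x \<le> u"
          then have "0 < u" using that by simp
          then show "\<exists>d. (\<eta> has_real_derivative d) (at u) \<and> d \<le> 0"
            using der[of u 0] nn[of u "Suc 0"] unfolding q0
            by (intro exI[of _ "- 2 * u * cm_deriv \<eta> (Suc 0) u"]) simp
        qed
        have "ennreal (z * \<eta> z) = (\<integral>\<^sup>+x. ennreal (\<eta> z) * indicator {0<..z} x \<partial>lborel)"
          using elim \<eta> by (subst nn_integral_cmult_indicator)
            (simp_all add: ennreal_mult'[symmetric] mult.commute)
        also have "\<dots> \<le> (\<integral>\<^sup>+x. ennreal (\<eta> x) * indicator {0<..} x \<partial>lborel)"
          using anti by (intro nn_integral_mono) (auto simp: indicator_def intro: ennreal_leI)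
        also have "\<dots> = ennreal (1 / 2)" by (rule m0)
        finally have "z * \<eta> z \<le> 1 / 2" by (subst (asm) ennreal_le_iff) simp_all
        then show ?case using elim by (simp add: q0 field_simps)
      qed
    qed
  qed
  have pos: "\<eta> y = std_normal_density y" if "0 < y" for y
    using q.eq_std_normal_density[OF _ _ _ that] m0
      half[OF assms(6,7)] half[OF assms(8,9)] by (simp add: q0)
  \<comment> \<open>Negative z are reached through evenness almost everywhere, and the point 0 is
    discarded as a null set.\<close>
  have "AE z in lborel. ennreal (\<eta> z) = ennreal (std_normal_density z)"
    using even AE_lborel_singleton[of 0]
  proof eventually_elim
    case (elim z)
    show ?case
    proof (cases "0 < z")
      case False
      then have "\<eta> (- z) = std_normal_density (- z)" using elim by (intro pos) simp
      then show ?thesis using elim by (simp add: normal_density_def)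
    qed (simp add: pos)
  qed
  then have "density lborel (\<lambda>z. ennreal (\<eta> z)) = density lborel (\<lambda>z. ennreal (std_normal_density z))"
    by (intro density_cong) simp_all
  then show ?thesis using dist by (simp add: distributed_def)
qed

end
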